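(* Let $m,n\in\mathbb{N}$ and let $\mathcal{A}=(a_{p_1\dots p_m})\in\mathbb{S}_{m,n}$. Then $\mathcal{A}\in GDD^+_{m,n}$ if and only if there exist real numbers $b^{\vec{i}}_{j}\ge 0$, for all $\vec{i}=(i_1,\dots,i_m)\in\mathscr{D}_n^m$ and $j\in\vec{i}$, satisfying: (i) for every $\vec{i}\in\mathscr{D}_n^m$, $$\prod_{k=1}^{l^{\vec{i}}}\bigl(b^{\vec{i}}_{j_k^{\vec{i}}}\bigr)^{\alpha_k^{\vec{i}}}\ \ge\ c(\vec{i})\,|a_{\vec{i}}|^m,\qquad c(\vec{i})=\prod_{k=1}^{l^{\vec{i}}}\binom{m-1}{\alpha^{\vec{i}}-e_k}^{\alpha_k^{\vec{i}}},$$ where $((j_1^{\vec{i}},\dots,j_{l^{\vec{i}}}^{\vec{i}}),\alpha^{\vec{i}}=(\alpha_1^{\vec{i}},\dots,\alpha_{l^{\vec{i}}}^{\vec{i}}))$ is the tight pair associated with $\vec{i}$; (ii) for every $j\in[n]$, $$a_{jj\dots j}\ \ge\ \sum_{\vec{i}\in\mathscr{D}_n^m:\ j\in\vec{i}} b^{\vec{i}}_{j}.$$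
   Context: $\mathbb{S}_{m,n}$ is the set of real symmetric tensors $\mathcal{A}=(a_{i_1\dots i_m})$ of order $m$ and dimension $n$ (indices in $[n]=\{1,\dots,n\}$, entries invariant under permutations of the indices). The diagonal elements are the entries $a_{ii\dots i}$. A tensor $\mathcal{A}$ is diagonally dominant (DD) if $|a_{ii\dots i}|\ge\sum_{(i_2,\dots,i_m)\ne(i,\dots,i)}|a_{ii_2\dots i_m}|$ for all $i\in[n]$. It is generalized diagonally dominant (GDD) if there is a diagonal matrix $D$ with positive diagonal entries $d_1,\dots,d_n$ such that the tensor with entries $a_{i_1\dots i_m}d_{i_1}^{1-m}d_{i_2}\cdots d_{i_m}$ is DD. A GDD$^+$ tensor is a GDD tensor with nonnegative diagonal elements; $GDD^+_{m,n}$ is the set of GDD$^+$ tensors in $\mathbb{S}_{m,n}$. (Symmetric $H^+$-tensors are exactly the elements of $GDD^+_{m,n}$.) $\mathscr{D}_n^m$ is the set of $\vec{i}=(i_1,\dots,i_m)$ with $1\le i_1\le\cdots\le i_m\le n$ that are not all equal; $j\in\vec{i}$ means $j\in\{i_1,\dots,i_m\}$; $a_{\vec{i}}=a_{i_1\dots i_m}$. The tight pair of $\vec{i}\in\mathscr{D}_n^m$ is $((j_1,\dots,j_l),(\alpha_1,\dots,\alpha_l))$, where $j_1<\dots<j_l$ are the distinct values among $i_1,\dots,i_m$ and $\alpha_k\ge1$ is the multiplicity of $j_k$, i.e. $x_{i_1}\cdots x_{i_m}=x_{j_1}^{\alpha_1}\cdots x_{j_l}^{\alpha_l}$. $e_k$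 is the $k$-th standard unit vector of $\mathbb{R}^l$, and $\binom{m-1}{\beta}=\frac{(m-1)!}{\beta_1!\cdots\beta_l!}$ is the multinomial coefficient. *)

theory Defs
  imports Complex_Main "HOL-Combinatorics.Permutations"
begin

text \<open>
  A real tensor of order \<open>m\<close> and dimension \<open>n\<close> is a function on index lists. Only its
  values on \<open>index_tuples m n\<close> matter; every notion below ignores the others.
\<close>

type_synonym tensor = "nat list \<Rightarrow> real"

definition index_tuples :: "nat \<Rightarrow> nat \<Rightarrow> nat list set" where
  "index_tuples m n = {is. length is = m \<and> set is \<subseteq> {1..n}}"

definition sym_tensors :: "nat \<Rightarrow> nat \<Rightarrow> tensor set" where
  "sym_tensors m n =
     {A. \<forall>is\<in>index_tuples m n. \<forall>p. p permutes {..<m} \<longrightarrow> A (permute_list p is) = A is}"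

definition diag_entry :: "nat \<Rightarrow> tensor \<Rightarrow> nat \<Rightarrow> real" where
  "diag_entry m A i = A (replicate m i)"

definition diag_dominant :: "nat \<Rightarrow> nat \<Rightarrow> tensor \<Rightarrow> bool" where
  "diag_dominant m n A \<longleftrightarrow>
     (\<forall>i\<in>{1..n}. \<bar>diag_entry m A i\<bar>
        \<ge> (\<Sum>is\<in>index_tuples (m - 1) n - {replicate (m - 1) i}. \<bar>A (i # is)\<bar>))"

text \<open>A diagonal matrix is given by the function \<open>d\<close> of its diagonal entries.\<close>

definition diag_scale :: "nat \<Rightarrow> (nat \<Rightarrow> real) \<Rightarrow> tensor \<Rightarrow> tensor" where
  "diag_scale m d A =
     (\<lambda>is. A is * d (hd is) powi (1 - int m) * prod_list (map d (tl is)))"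

definition gen_diag_dominant :: "nat \<Rightarrow> nat \<Rightarrow> tensor \<Rightarrow> bool" where
  "gen_diag_dominant m n A \<longleftrightarrow>
     (\<exists>d. (\<forall>i\<in>{1..n}. d i > 0) \<and> diag_dominant m n (diag_scale m d A))"

definition GDD_plus :: "nat \<Rightarrow> nat \<Rightarrow> tensor set" where
  "GDD_plus m n =
     {A \<in> sym_tensors m n. gen_diag_dominant m n A \<and> (\<forall>i\<in>{1..n}. diag_entry m A i \<ge> 0)}"

definition offdiag_indices :: "nat \<Rightarrow> nat \<Rightarrow> nat list set" where
  "offdiag_indices m n =
     {is \<in> index_tuples m n. sorted is \<and> (\<exists>j\<in>set is. \<exists>k\<in>set is. j \<noteq> k)}"

definition tight_pair :: "nat list \<Rightarrow> nat list \<times> nat list" where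
  "tight_pair is =
     (let js = sorted_list_of_set (set is) in (js, map (count_list is) js))"

definition multinomial :: "nat \<Rightarrow> nat list \<Rightarrow> real" where
  "multinomial N \<beta> = fact N / prod_list (map fact \<beta>)"

definition minus_unit :: "nat list \<Rightarrow> nat \<Rightarrow> nat list" where
  "minus_unit \<alpha> k = \<alpha>[k := \<alpha> ! k - 1]"

text \<open>
  The constant \<open>c\<close>. List positions are counted from \<open>0\<close>. The subtraction in
  \<^const>\<open>minus_unit\<close> never truncates here, since all multiplicities are at least \<open>1\<close>.
\<close>

definition tight_const :: "nat \<Rightarrow> nat list \<Rightarrow> real" where
  "tight_const m is =
     (let (js, \<alpha>) = tight_pair is
      in \<Prod>k<length js. multinomial (m - 1) (minus_unit \<alpha> k) ^ (\<alpha> ! k))"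

end

theory Submission
  imports Defs "HOL-Analysis.Analysis" "HOL-Combinatorics.Multiset_Permutations"
begin

text \<open>
  Write \<open>d\<^sub>j = exp (x\<^sub>j)\<close> for the scaling. By symmetry of \<open>A\<close>, the terms of row \<open>j\<close> of the scaled
  tensor that belong to one multiset of indices \<open>is\<close> are equal, and there are \<open>\<alpha>\<^sub>j N / m\<close> of them, where \<open>\<alpha>\<^sub>j\<close> is the
  multiplicity of \<open>j\<close> and \<open>N\<close> is the number of rearrangements of \<open>is\<close>. So \<open>A\<close> is
  GDD\<open>\<^sup>+\<close> iff its diagonal is nonnegative and, for some \<open>x\<close> and all \<open>j\<close>,

    \<open>\<Sum>\<^sub>i\<^sub>s \<alpha>\<^sub>j N \<bar>A is\<bar> / m * exp (\<Sum>\<^sub>p x\<^sub>p - m x\<^sub>j) \<le> A j\<dots>j\<close>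

  (lemma \<open>GDD_plus_iff_exp_row_sums\<close>). The coefficient \<open>\<alpha>\<^sub>j N / m\<close> is also the multinomial
  coefficient that occurs in the constant \<open>c\<close>.

  From such an \<open>x\<close>, the summands of these rows are the required numbers \<open>b\<close>: since the exponents,
  weighted by \<open>\<alpha>\<^sub>j\<close>, sum to zero, the products in (i) are equal to \<open>c \<bar>A is\<bar>\<^sup>m\<close>.

  Conversely, (i) and the inequality between arithmetic and geometric means give
  \<open>N \<bar>A is\<bar> exp (\<Sum>\<^sub>p x\<^sub>p) \<le> \<Sum>\<^sub>j b\<^sub>j exp (m x\<^sub>j)\<close> for every \<open>x\<close>. Summing over \<open>is\<close> and using (ii), the form

    \<open>G x = \<Sum>\<^sub>j A j\<dots>j exp (m x\<^sub>j) - \<Sum>\<^sub>i\<^sub>s N \<bar>A is\<bar> exp (\<Sum>\<^sub>p x\<^sub>p)\<close>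

  is nonnegative everywhere, while the row inequality at \<open>j\<close> says that the partial derivative of
  \<open>G\<close> in direction \<open>j\<close> is nonnegative. What remains is to find one point at which all
  partial derivatives of a nonnegative \<open>G\<close> are nonnegative (lemma \<open>row_dominance_of_nonneg_form\<close>).

  Let \<open>G\<^sub>\<epsilon>\<close> arise from \<open>G\<close> by adding \<open>\<epsilon> > 0\<close> to each diagonal entry. Then \<open>G\<^sub>\<epsilon> x - \<Sum>\<^sub>j x\<^sub>j\<close> is coercive,
  and at its minimum the partial derivatives of \<open>G\<^sub>\<epsilon>\<close> are \<open>1\<close>. As \<open>\<epsilon>\<close> tends to \<open>0\<close> these points may escape to infinity.
  But a nonzero entry at \<open>is\<close> bounds, uniformly in \<open>\<epsilon> \<le> 1\<close>, the differences \<open>x\<^sub>j - x\<^sub>k\<close> for \<open>j\<close>, \<open>k\<close> in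
  \<open>is\<close>, so the differences are bounded on each connected component of the hypergraph of nonzero
  entries. The row inequalities do not change when a constant is subtracted from \<open>x\<close> on a
  component, so one coordinate per component can be normalized to \<open>0\<close>. The normalized points stay
  in a compact box, and a limit point is the desired \<open>x\<close>.
\<close>

section \<open>Rearrangements and multinomial coefficients\<close>

text \<open>
  The multinomial coefficient of the multiplicities of \<open>is\<close>, in the form of a cardinality because
  it enters row sums as the size of a set of index lists.
\<close>

definition num_arrangements :: "'a list \<Rightarrow> real" where
  "num_arrangements is = real (card (permutations_of_multiset (mset is)))"

lemma num_arrangements_nonneg: "num_arrangements is \<ge> 0"
  by (simp add: num_arrangements_def)

lemma num_arrangements_mult_fact:
  "num_arrangements is * (\<Prod>j\<in>set is. fact (count_list is j)) = fact (length is)"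
proof -
  have "real (card (permutations_of_multiset (mset is)) *
      (\<Prod>j\<in>set_mset (mset is). fact (count (mset is) j))) = real (fact (size (mset is)))"
    by (subst card_permutations_of_multiset_aux) simp
  then show ?thesis by (simp add: num_arrangements_def count_mset)
qed

lemma prod_nth_sorted_list_of_set:
  assumes "finite S"
  shows "(\<Prod>k<length (sorted_list_of_set S). f (sorted_list_of_set S ! k)) = prod f S"
proof -
  have "bij_betw (\<lambda>k. sorted_list_of_set S ! k) {..<length (sorted_list_of_set S)} S"
    using assms by (intro bij_betw_nth) auto
  then show ?thesis by (rule prod.reindex_bij_betw)
qed

text \<open>
  The coefficient of \<open>\<alpha> - e\<^sub>k\<close> counts the rearrangements that start with \<open>j\<^sub>k\<close>, which are the fraction
  \<open>\<alpha>\<^sub>k / m\<close> of all.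
\<close>

lemma multinomial_minus_unit_tight_pair:
  assumes "tight_pair is = (js, \<alpha>)" "k < length js"
  shows "multinomial (length is - 1) (minus_unit \<alpha> k) =
    num_arrangements is * count_list is (js ! k) / length is"
proof -
  have js: "js = sorted_list_of_set (set is)" and \<alpha>: "\<alpha> = map (count_list is) js"
    using assms(1) by (auto simp: tight_pair_def Let_def)
  have "js ! k \<in> set js" using assms(2) by simp
  then have in_is: "js ! k \<in> set is" by (simp add: js)
  then have pos: "count_list is (js ! k) \<noteq> 0" "length is > 0"
    by (auto simp: count_list_0_iff)
  define P :: real where "P = (\<Prod>i\<in>{..<length js} - {k}. fact (\<alpha> ! i))"
  have "P > 0" unfolding P_def by (intro prod_pos) auto
  have len: "length \<alpha> = length js" by (simp add: \<alpha>)
  have "prod_list (map fact (minus_unit \<alpha> k)) =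
      (\<Prod>i<length js. fact (minus_unit \<alpha> k ! i) :: real)"
    by (simp add: prod.list_conv_set_nth atLeast0LessThan minus_unit_def len)
  also have "\<dots> = fact (\<alpha> ! k - 1) * P"
    using assms(2) by (subst prod.remove[of _ k]) (auto simp: P_def minus_unit_def len)
  finally have 1: "prod_list (map fact (minus_unit \<alpha> k)) = fact (\<alpha> ! k - 1) * P" .
  have "(\<Prod>j\<in>set is. fact (count_list is j)) = (\<Prod>i<length js. fact (\<alpha> ! i) :: real)"
    by (subst prod_nth_sorted_list_of_set[symmetric]) (auto simp: js \<alpha>)
  also have "\<dots> = fact (\<alpha> ! k) * P"
    using assms(2) by (subst prod.remove[of _ k]) (auto simp: P_def)
  also have "fact (\<alpha> ! k) = real (\<alpha> ! k) * fact (\<alpha> ! k - 1)"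
    using pos assms(2) by (intro fact_reduce) (auto simp: \<alpha>)
  finally have "num_arrangements is * (real (\<alpha> ! k) * fact (\<alpha> ! k - 1) * P) = fact (length is)"
    using num_arrangements_mult_fact[of "is"] by simp
  also have "\<dots> = real (length is) * fact (length is - 1)"
    using pos by (intro fact_reduce) auto
  finally show ?thesis
    using pos \<open>P > 0\<close> assms(2) unfolding multinomial_def 1
    by (simp add: \<alpha> field_simps)
qed

lemma tight_pair_prod_eq:
  assumes "tight_pair is = (js, \<alpha>)"
  shows "(\<Prod>k<length js. f (js ! k) ^ (\<alpha> ! k)) = (\<Prod>j\<in>set is. f j ^ count_list is j)"
proof -
  have js: "js = sorted_list_of_set (set is)" and \<alpha>: "\<alpha> = map (count_list is) js"
    using assms(1) by (auto simp: tight_pair_def Let_def)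
  show ?thesis
    by (subst prod_nth_sorted_list_of_set[symmetric]) (auto simp: js \<alpha>)
qed

lemma tight_const_eq:
  "tight_const (length is) is =
    (\<Prod>j\<in>set is. (num_arrangements is * count_list is j / length is) ^ count_list is j)"
proof -
  obtain js \<alpha> where tp: "tight_pair is = (js, \<alpha>)" by fastforce
  show ?thesis
    unfolding tight_pair_prod_eq[OF tp, symmetric] tight_const_def tp Let_def prod.case
    by (intro prod.cong) (auto simp: multinomial_minus_unit_tight_pair[OF tp] simp del: One_nat_def)
qed

section \<open>The inequality of arithmetic and geometric means on an index list\<close>

lemma sum_list_map_eq_sum_count_list:
  fixes f :: "'a \<Rightarrow> real"
  shows "sum_list (map f is) = (\<Sum>j\<in>set is. count_list is j * f j)"
proof -
  have "sum_list (map f is) = (\<Sum>j\<in>S. count_list is j * f j)" if "finite S" "set is \<subseteq> S" for S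
    using that(2)
  proof (induction "is")
    case (Cons a as)
    have "(\<Sum>j\<in>S. count_list (a # as) j * f j)
        = (\<Sum>j\<in>S. count_list as j * f j + (if j = a then f j else 0))"
      by (intro sum.cong) (auto simp: algebra_simps)
    with Cons that(1) show ?case by (simp add: sum.distrib)
  qed simp
  then show ?thesis by blast
qed

lemma prod_list_map_eq_prod_count_list:
  fixes f :: "'a \<Rightarrow> 'b::comm_monoid_mult"
  shows "prod_list (map f is) = (\<Prod>j\<in>set is. f j ^ count_list is j)"
  using image_prod_mset_multiplicity[of f "mset is"]
  by (simp add: count_mset flip: prod_mset_prod_list)

lemma prod_power_count_le_mean_power:
  fixes u :: "'a \<Rightarrow> real"
  assumes "is \<noteq> []" and u: "\<And>j. j \<in> set is \<Longrightarrow> u j \<ge> 0"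
  shows "(\<Prod>j\<in>set is. u j ^ count_list is j)
    \<le> ((\<Sum>j\<in>set is. count_list is j * u j) / length is) ^ length is"
proof -
  let ?m = "length is"
  let ?P = "\<Prod>i<?m. u (is ! i)" and ?S = "\<Sum>i<?m. u (is ! i) / ?m"
  have P: "?P = (\<Prod>j\<in>set is. u j ^ count_list is j)"
    unfolding prod_list_map_eq_prod_count_list[symmetric]
    by (simp add: prod.list_conv_set_nth atLeast0LessThan)
  have S: "?S = (\<Sum>j\<in>set is. count_list is j * u j) / ?m"
    unfolding sum_list_map_eq_sum_count_list[symmetric]
    by (simp add: sum_list_sum_nth atLeast0LessThan sum_divide_distrib)
  have P0: "?P \<ge> 0" using u by (intro prod_nonneg) auto
  have "?P powr (1 / ?m) \<le> ?S"
    using arith_geom_mean[of "{..<?m}" "\<lambda>i. u (is ! i)"] assms by auto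
  then have "(?P powr (1 / ?m)) ^ ?m \<le> ?S ^ ?m" by (intro power_mono) auto
  moreover have "(y powr (1 / ?m)) ^ ?m = y" if "y \<ge> 0" for y :: real
    using that assms(1) by (cases "y = 0") (simp_all add: powr_power)
  note this[OF P0]
  ultimately show ?thesis by (simp only: P S)
qed

lemma prod_power_count_list_const:
  fixes y :: real
  shows "(\<Prod>j\<in>set is. y ^ count_list is j) = y ^ length is"
  using prod_list_map_eq_prod_count_list[of "\<lambda>_. y" "is"] by (simp add: map_replicate_const)

text \<open>
  The summands of the scaled rows satisfy (i) with equality: the mean of \<open>m x\<^sub>j\<close> with weights \<open>\<alpha>\<^sub>j\<close>
  is \<open>\<Sum>\<^sub>p x\<^sub>p\<close>, so the exponentials cancel in the product.
\<close>

lemma prod_scaled_entries_eq_tight_const: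
  fixes x :: "nat \<Rightarrow> real"
  assumes len: "length is = m"
  shows "(\<Prod>j\<in>set is. (num_arrangements is * count_list is j / m *
      (\<bar>a\<bar> * exp (sum_list (map x is) - m * x j))) ^ count_list is j) = tight_const m is * \<bar>a\<bar> ^ m"
proof -
  let ?c = "\<lambda>j. count_list is j" and ?s = "sum_list (map x is)"
  have "(\<Sum>j\<in>set is. ?c j * (?s - m * x j)) = sum_list (map (\<lambda>j. ?s - m * x j) is)"
    by (simp add: sum_list_map_eq_sum_count_list)
  also have "\<dots> = 0"
    using len by (simp add: sum_list_subtractf sum_list_triv sum_list_const_mult)
  finally have "(\<Prod>j\<in>set is. exp (?s - m * x j) ^ ?c j) = 1"
    by (simp flip: exp_of_nat_mult exp_sum)
  then show ?thesis
    using tight_const_eq[of "is"] prod_power_count_list_const[of "\<bar>a\<bar>" "is"]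
    by (simp only: len power_mult_distrib prod.distrib mult_1_right)
qed

text \<open>
  This is the inequality of arithmetic and geometric means for the numbers
  \<open>(m / \<alpha>\<^sub>j) b\<^sub>j exp (m x\<^sub>j)\<close> with weights \<open>\<alpha>\<^sub>j / m\<close>. The constant \<open>c\<close> is such that the factors \<open>m / \<alpha>\<^sub>j\<close>
  turn it into the \<open>m\<close>-th power of the number of rearrangements.
\<close>

lemma monomial_le_sum_powers:
  fixes b x :: "nat \<Rightarrow> real"
  assumes len: "length is = m" and m: "m \<ge> 1"
    and b: "\<And>j. j \<in> set is \<Longrightarrow> b j \<ge> 0"
    and tight: "tight_const m is * \<bar>a\<bar> ^ m \<le> (\<Prod>j\<in>set is. b j ^ count_list is j)"
  shows "num_arrangements is * \<bar>a\<bar> * exp (sum_list (map x is)) \<le> (\<Sum>j\<in>set is. b j * exp (m * x j))"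
proof -
  let ?c = "\<lambda>j. count_list is j" and ?N = "num_arrangements is"
  have c: "?c j > 0" if "j \<in> set is" for j using that by (simp add: count_list_0_iff zero_less_iff_neq_zero)
  note total = prod_power_count_list_const[of _ "is", unfolded len]
  have pos: "0 \<le> (\<Prod>j\<in>set is. (m / ?c j * exp (m * x j)) ^ ?c j)"
    by (intro prod_nonneg) auto
  have "(?N * \<bar>a\<bar> * exp (sum_list (map x is))) ^ m
      = ?N ^ m * \<bar>a\<bar> ^ m * (\<Prod>j\<in>set is. exp (m * x j) ^ ?c j)"
  proof -
    have "exp (sum_list (map x is)) ^ m = (\<Prod>j\<in>set is. exp (m * x j) ^ ?c j)"
      by (simp add: sum_list_map_eq_sum_count_list exp_sum prod_power_distrib mult_ac
          flip: exp_of_nat_mult)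
    then show ?thesis by (simp add: power_mult_distrib)
  qed
  also have "?N ^ m = tight_const m is * (\<Prod>j\<in>set is. (m / ?c j) ^ ?c j)"
  proof -
    have "tight_const m is * (\<Prod>j\<in>set is. (m / ?c j) ^ ?c j)
        = (\<Prod>j\<in>set is. (?N * ?c j / m * (m / ?c j)) ^ ?c j)"
      using tight_const_eq[of "is"]
      by (simp only: len power_mult_distrib prod.distrib)
    also have "\<dots> = (\<Prod>j\<in>set is. ?N ^ ?c j)"
      using m c by (intro prod.cong) auto
    finally show ?thesis by (simp only: total)
  qed
  also have "tight_const m is * (\<Prod>j\<in>set is. (m / ?c j) ^ ?c j) * \<bar>a\<bar> ^ m * (\<Prod>j\<in>set is. exp (m * x j) ^ ?c j)
      = (tight_const m is * \<bar>a\<bar> ^ m) * (\<Prod>j\<in>set is. (m / ?c j * exp (m * x j)) ^ ?c j)"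
    by (simp only: prod.distrib power_mult_distrib mult_ac)
  also have "\<dots> \<le> (\<Prod>j\<in>set is. b j ^ ?c j) * (\<Prod>j\<in>set is. (m / ?c j * exp (m * x j)) ^ ?c j)"
    using tight pos by (rule mult_right_mono)
  also have "\<dots> = (\<Prod>j\<in>set is. (b j * (m / ?c j * exp (m * x j))) ^ ?c j)"
    by (simp only: prod.distrib power_mult_distrib)
  also have "\<dots> \<le> ((\<Sum>j\<in>set is. ?c j * (b j * (m / ?c j * exp (m * x j)))) / m) ^ m"
    using m b unfolding len[symmetric]
    by (intro prod_power_count_le_mean_power mult_nonneg_nonneg) auto
  also have "(\<Sum>j\<in>set is. ?c j * (b j * (m / ?c j * exp (m * x j)))) / m = (\<Sum>j\<in>set is. b j * exp (m * x j))"
    unfolding sum_divide_distrib using c m by (intro sum.cong) auto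
  finally show ?thesis
    using m b by (subst (asm) power_mono_iff) (auto intro!: sum_nonneg mult_nonneg_nonneg num_arrangements_nonneg)
qed

section \<open>Generalized diagonal dominance in logarithmic coordinates\<close>

lemma sym_tensor_mset_cong:
  assumes "A \<in> sym_tensors m n" "is \<in> index_tuples m n" "mset js = mset is"
  shows "A js = A is"
proof -
  obtain p where "p permutes {..<length is}" "permute_list p is = js"
    using mset_eq_permutation[OF assms(3)] by blast
  then show ?thesis using assms(1,2) by (auto simp: sym_tensors_def index_tuples_def)
qed

lemma finite_index_tuples: "finite (index_tuples m n)"
  using finite_lists_length_eq[of "{1..n}" m] by (simp add: index_tuples_def conj_commute)

lemma finite_offdiag_indices: "finite (offdiag_indices m n)"
  by (rule finite_subset[OF _ finite_index_tuples[of m n]]) (auto simp: offdiag_indices_def)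

lemma offdiag_indicesD:
  assumes "is \<in> offdiag_indices m n"
  shows "length is = m" "set is \<subseteq> {1..n}"
  using assms by (auto simp: offdiag_indices_def index_tuples_def)

text \<open>
  Sorting \<open>j # t\<close> groups the off-diagonal positions of row \<open>j\<close>. The fibre over \<open>is\<close> consists of the
  rearrangements of \<open>is\<close> with one \<open>j\<close> removed.
\<close>

lemma sum_index_tuples_by_multiset:
  fixes F :: "nat list \<Rightarrow> real"
  assumes m: "m \<ge> 1" and j: "j \<in> {1..n}"
    and F: "\<And>is js. is \<in> index_tuples m n \<Longrightarrow> mset js = mset is \<Longrightarrow> F js = F is"
  shows "(\<Sum>t\<in>index_tuples (m - 1) n - {replicate (m - 1) j}. F (j # t))
    = (\<Sum>is | is \<in> offdiag_indices m n \<and> j \<in> set is. num_arrangements is * count_list is j / m * F is)"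
    (is "sum _ ?S = sum _ ?T")
proof -
  have cons_index: "j # t \<in> index_tuples m n" if "t \<in> index_tuples (m - 1) n" for t
    using that m j by (auto simp: index_tuples_def)
  have "(\<lambda>t. sort (j # t)) ` ?S \<subseteq> ?T"
  proof (intro image_subsetI)
    fix t assume t: "t \<in> ?S"
    have "\<exists>k\<in>set t. k \<noteq> j"
    proof (rule ccontr)
      assume "\<not> (\<exists>k\<in>set t. k \<noteq> j)"
      then have "t = replicate (m - 1) j"
        using t by (intro replicate_eqI) (auto simp: index_tuples_def)
      with t show False by simp
    qed
    then have "\<exists>k\<in>set (j # t). \<exists>l\<in>set (j # t). k \<noteq> l" by auto
    moreover have "sort (j # t) \<in> index_tuples m n"
      using cons_index[of t] t by (simp add: index_tuples_def del: sort_key_simps)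
    ultimately show "sort (j # t) \<in> ?T"
      by (simp add: offdiag_indices_def del: sort_key_simps)
  qed
  moreover have "{t \<in> ?S. sort (j # t) = is} = permutations_of_multiset (mset is - {#j#})"
    if "is": "is \<in> ?T" for "is"
  proof -
    have srt: "sorted is" using "is" by (simp add: offdiag_indices_def)
    have eq: "sort (j # t) = is \<longleftrightarrow> mset t = mset is - {#j#}" for t
    proof
      assume "sort (j # t) = is"
      then show "mset t = mset is - {#j#}" by (metis add_mset_remove_trivial mset.simps(2) mset_sort)
    next
      assume "mset t = mset is - {#j#}"
      then have "mset is = mset (j # t)" using "is" by simp
      then show "sort (j # t) = is" using srt by (metis properties_for_sort)
    qed
    have "t \<in> ?S" if t: "mset t = mset is - {#j#}" for t
    proof -
      have ms: "mset is = mset (j # t)" using "is" t by simp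
      then have s: "set is = set (j # t)" and l: "length is = length (j # t)"
        by (metis mset_eq_setD, metis mset_eq_length)
      have "t \<noteq> replicate (m - 1) j"
      proof
        assume "t = replicate (m - 1) j"
        then have "set is \<subseteq> {j}" using s by (auto split: if_splits)
        then show False using "is" by (auto simp: offdiag_indices_def)
      qed
      then show ?thesis using s l "is" by (auto simp: offdiag_indices_def index_tuples_def)
    qed
    then show ?thesis by (auto simp: eq permutations_of_multiset_def simp del: sort_key_simps)
  qed
  ultimately have "(\<Sum>t\<in>?S. F (j # t)) = (\<Sum>is\<in>?T. \<Sum>t\<in>permutations_of_multiset (mset is - {#j#}). F (j # t))"
    by (subst sum.group[symmetric, where T = ?T and g = "\<lambda>t. sort (j # t)"])
      (auto intro: finite_subset[OF _ finite_offdiag_indices] finite_index_tuples)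
  also have "\<dots> = (\<Sum>is\<in>?T. num_arrangements is * count_list is j / m * F is)"
  proof (rule sum.cong[OF refl])
    fix "is" assume "is": "is \<in> ?T"
    have "F (j # t) = F is" if "t \<in> permutations_of_multiset (mset is - {#j#})" for t
      using "is" that by (intro F) (auto simp: offdiag_indices_def permutations_of_multiset_def)
    then have "(\<Sum>t\<in>permutations_of_multiset (mset is - {#j#}). F (j # t))
        = card (permutations_of_multiset (mset is - {#j#})) * F is" by simp
    also have "\<dots> = num_arrangements is * count_list is j / m * F is"
      using "is" real_card_permutations_of_multiset_remove[of j "mset is"] offdiag_indicesD(1)[of "is" m n]
      by (simp add: num_arrangements_def count_mset)
    finally show "(\<Sum>t\<in>permutations_of_multiset (mset is - {#j#}). F (j # t)) = \<dots>" .
  qed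
  finally show ?thesis .
qed

lemma diag_scale_exp:
  assumes "\<And>p. p \<in> set (j # t) \<Longrightarrow> d p = exp (x p)"
  shows "diag_scale m d A (j # t) = A (j # t) * exp (sum_list (map x (j # t)) - m * x j)"
proof -
  have "prod_list (map d t) = exp (sum_list (map x t))"
    using assms by (induction t) (auto simp: exp_add)
  moreover have "d j powi (1 - int m) = exp ((1 - real m) * x j)"
    using assms by (simp add: exp_power_int)
  ultimately show ?thesis
    by (simp add: diag_scale_def algebra_simps flip: exp_add)
qed

lemma GDD_plus_iff_exp_row_sums:
  assumes A: "A \<in> sym_tensors m n" and m: "m \<ge> 1"
  shows "A \<in> GDD_plus m n \<longleftrightarrow> (\<forall>j\<in>{1..n}. diag_entry m A j \<ge> 0) \<and>
    (\<exists>x. \<forall>j\<in>{1..n}. (\<Sum>is | is \<in> offdiag_indices m n \<and> j \<in> set is.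
        num_arrangements is * count_list is j / m * (\<bar>A is\<bar> * exp (sum_list (map x is) - m * x j)))
      \<le> diag_entry m A j)" (is "_ \<longleftrightarrow> ?nonneg \<and> (\<exists>x. \<forall>j\<in>_. ?row x j \<le> _)")
proof -
  have dom: "diag_dominant m n (diag_scale m d A) \<longleftrightarrow> (\<forall>j\<in>{1..n}. ?row x j \<le> \<bar>diag_entry m A j\<bar>)"
    if d: "\<And>j. j \<in> {1..n} \<Longrightarrow> d j = exp (x j)" for d x
    unfolding diag_dominant_def
  proof (intro ball_cong refl)
    fix j assume j: "j \<in> {1..n}"
    let ?F = "\<lambda>is. \<bar>A is\<bar> * exp (sum_list (map x is) - m * x j)"
    have "replicate m j = j # replicate (m - 1) j" using m by (cases m) auto
    then have "diag_entry m (diag_scale m d A) j = diag_entry m A j"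
      using d[OF j] diag_scale_exp[of j "replicate (m - 1) j" d x m A] m
      by (auto simp: diag_entry_def sum_list_replicate algebra_simps of_nat_diff)
    moreover have "(\<Sum>t\<in>index_tuples (m - 1) n - {replicate (m - 1) j}. \<bar>diag_scale m d A (j # t)\<bar>)
        = (\<Sum>t\<in>index_tuples (m - 1) n - {replicate (m - 1) j}. ?F (j # t))"
    proof (rule sum.cong[OF refl])
      fix t assume "t \<in> index_tuples (m - 1) n - {replicate (m - 1) j}"
      then have "d p = exp (x p)" if "p \<in> set (j # t)" for p
        using d j that by (auto simp: index_tuples_def)
      then show "\<bar>diag_scale m d A (j # t)\<bar> = ?F (j # t)"
        by (subst diag_scale_exp) (auto simp: abs_mult)
    qed
    moreover have "\<dots> = ?row x j"
    proof (rule sum_index_tuples_by_multiset[OF m j])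
      fix "is" js assume h: "is \<in> index_tuples m n" "mset js = mset is"
      have "sum_list (map x js) = sum_list (map x is)"
        using h(2) by (metis mset_map sum_mset_sum_list)
      then show "?F js = ?F is" using sym_tensor_mset_cong[OF A h] by simp
    qed
    ultimately show "(\<bar>diag_entry m (diag_scale m d A) j\<bar> \<ge>
        (\<Sum>t\<in>index_tuples (m - 1) n - {replicate (m - 1) j}. \<bar>diag_scale m d A (j # t)\<bar>)) =
      (?row x j \<le> \<bar>diag_entry m A j\<bar>)" by simp
  qed
  have "gen_diag_dominant m n A \<longleftrightarrow> (\<exists>x. \<forall>j\<in>{1..n}. ?row x j \<le> \<bar>diag_entry m A j\<bar>)"
  proof
    assume "gen_diag_dominant m n A"
    then obtain d where d: "\<forall>i\<in>{1..n}. d i > 0" "diag_dominant m n (diag_scale m d A)"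
      by (auto simp: gen_diag_dominant_def)
    have "\<forall>j\<in>{1..n}. ?row (\<lambda>j. ln (d j)) j \<le> \<bar>diag_entry m A j\<bar>"
      using d dom[of d "\<lambda>j. ln (d j)"] by simp
    then show "\<exists>x. \<forall>j\<in>{1..n}. ?row x j \<le> \<bar>diag_entry m A j\<bar>" by (rule exI[where x = "\<lambda>j. ln (d j)"])
  next
    assume "\<exists>x. \<forall>j\<in>{1..n}. ?row x j \<le> \<bar>diag_entry m A j\<bar>"
    then obtain x where "\<forall>j\<in>{1..n}. ?row x j \<le> \<bar>diag_entry m A j\<bar>" by blast
    then have "diag_dominant m n (diag_scale m (\<lambda>j. exp (x j)) A)"
      using dom[of "\<lambda>j. exp (x j)" x] by simp
    then show "gen_diag_dominant m n A"
      unfolding gen_diag_dominant_def by (intro exI[of _ "\<lambda>j. exp (x j)"]) simp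
  qed
  moreover have "(\<exists>x. \<forall>j\<in>{1..n}. ?row x j \<le> \<bar>diag_entry m A j\<bar>) \<longleftrightarrow>
      (\<exists>x. \<forall>j\<in>{1..n}. ?row x j \<le> diag_entry m A j)" if ?nonneg
    using that by (intro ex_cong1 ball_cong refl) (simp only: abs_of_nonneg)
  ultimately show ?thesis
    using A unfolding GDD_plus_def by blast
qed

section \<open>Row dominance of nonnegative forms\<close>

lemma compact_Pi_UNIV:
  fixes S :: "'a \<Rightarrow> 'b::topological_space set"
  assumes "\<And>j. compact (S j)"
  shows "compact (Pi UNIV S)"
proof -
  have "compactin (product_topology (\<lambda>_. euclidean) UNIV) (PiE UNIV S)"
    using assms by (subst compactin_PiE) auto
  then show ?thesis
    by (simp add: euclidean_product_topology PiE_UNIV_domain)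
qed

lemma sum_list_map_fun_upd:
  fixes x :: "'a \<Rightarrow> real"
  shows "sum_list (map (x(j := t)) is) = sum_list (map x is) + real (count_list is j) * (t - x j)"
  by (induction "is") (auto simp: algebra_simps)

lemma continuous_on_sum_list_coords:
  "continuous_on S (\<lambda>x :: 'a \<Rightarrow> real. sum_list (map x is))"
proof (induction "is")
  case (Cons a as)
  have "continuous_on S (\<lambda>x :: 'a \<Rightarrow> real. x a)"
    by (rule continuous_on_subset[OF continuous_on_product_coordinates]) auto
  with Cons show ?case by (auto intro!: continuous_intros)
qed auto

text \<open>
  Coercivity in one variable. The constant comes from \<open>e t\<^sup>2 / 2 - 2 t + 2 / e = (e / 2) (t - 2 / e)\<^sup>2 \<ge> 0\<close>,
  where \<open>t\<^sup>2 / 2\<close> is a lower bound of \<open>exp t\<close> for \<open>t \<ge> 0\<close>.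
\<close>

lemma exp_minus_linear_ge_abs:
  fixes e t :: real and m :: nat
  assumes "e > 0" "m \<ge> 1"
  shows "e * exp (m * t) - t \<ge> \<bar>t\<bar> - 2 / e"
proof (cases "t \<le> 0")
  case True
  have "0 \<le> e * exp (m * t)" "0 \<le> 2 / e" using assms by auto
  with True show ?thesis by linarith
next
  case False
  have "t * 1 \<le> t * real m"
    using assms False by (intro mult_left_mono) auto
  then have "t \<le> m * t" by (simp add: mult.commute)
  then have "exp t \<le> exp (m * t)" by simp
  moreover have "1 + t + t\<^sup>2 / 2 \<le> exp t"
    using exp_lower_Taylor_quadratic[of t] False by simp
  ultimately have "t\<^sup>2 / 2 \<le> exp (m * t)" using False by linarith
  then have "e * (t\<^sup>2 / 2) \<le> e * exp (m * t)" using assms by (intro mult_left_mono) auto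
  moreover have "0 \<le> (e / 2) * (t - 2 / e)\<^sup>2" using assms by simp
  moreover have "(e / 2) * (t - 2 / e)\<^sup>2 = e * (t\<^sup>2 / 2) - 2 * t + 2 / e"
    using assms by (simp add: power2_eq_square field_simps)
  ultimately show ?thesis using False by linarith
qed

text \<open>
  At a minimum of the form with perturbed diagonal minus \<open>\<Sum>\<^sub>j x\<^sub>j\<close>, each partial derivative of the
  perturbed form equals \<open>1\<close>. The perturbation makes this function dominate \<open>\<Sum>\<^sub>j \<bar>x\<^sub>j\<bar>\<close> up to a constant, so the
  minimum over a large box is a global one.
\<close>

lemma strict_row_dominance_of_nonneg_form:
  fixes w :: "'a list \<Rightarrow> real" and a :: "'a \<Rightarrow> real" and m :: nat
  assumes J: "finite J" and I: "finite I" and m: "m \<ge> 1" and e: "e > 0"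
    and nonneg: "\<And>x :: 'a \<Rightarrow> real.
      (\<Sum>is\<in>I. w is * exp (sum_list (map x is))) \<le> (\<Sum>j\<in>J. a j * exp (m * x j))"
  shows "\<exists>x :: 'a \<Rightarrow> real. \<forall>j\<in>J.
    (\<Sum>is\<in>I. count_list is j * w is * exp (sum_list (map x is))) < m * (a j + e) * exp (m * x j)"
proof -
  define H where "H x = (\<Sum>j\<in>J. (a j + e) * exp (m * x j))
      - (\<Sum>is\<in>I. w is * exp (sum_list (map x is))) - (\<Sum>j\<in>J. x j)" for x :: "'a \<Rightarrow> real"
  have H_ge: "(\<Sum>j\<in>J. \<bar>x j\<bar> - 2 / e) \<le> H x" for x
  proof -
    have "(\<Sum>j\<in>J. \<bar>x j\<bar> - 2 / e) \<le> (\<Sum>j\<in>J. e * exp (m * x j) - x j)"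
      using exp_minus_linear_ge_abs[OF e m] by (intro sum_mono) auto
    also have "\<dots> = (\<Sum>j\<in>J. (a j + e) * exp (m * x j))
        - (\<Sum>j\<in>J. a j * exp (m * x j)) - (\<Sum>j\<in>J. x j)"
      by (simp add: sum_subtractf[symmetric] algebra_simps)
    also have "\<dots> \<le> H x" using nonneg[of x] by (simp add: H_def)
    finally show ?thesis .
  qed
  define R where "R = \<bar>H (\<lambda>_. 0)\<bar> + card J * (2 / e)"
  \<comment> \<open>At points that vanish outside \<open>J\<close> and are not in \<open>box\<close>, the lower bound \<open>H_ge\<close> exceeds the value
    of \<open>H\<close> at the origin. Coordinates outside \<open>J\<close> are not controlled by that bound and are pinned to \<open>0\<close>.\<close>
  define box where "box = Pi UNIV (\<lambda>j. if j \<in> J then {-R..R} else {0::real})"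
  have R: "R \<ge> 0" using e by (simp add: R_def)
  have "compact box"
    unfolding box_def by (rule compact_Pi_UNIV) auto
  moreover have zero: "(\<lambda>_. 0) \<in> box" using R by (auto simp: box_def)
  moreover have "continuous_on box H"
  proof -
    have "continuous_on box (\<lambda>x :: 'a \<Rightarrow> real. x j)" for j
      by (rule continuous_on_subset[OF continuous_on_product_coordinates]) auto
    then show ?thesis unfolding H_def
      by (intro continuous_intros continuous_on_sum_list_coords) auto
  qed
  ultimately obtain x where x: "x \<in> box" and min_box: "\<And>y. y \<in> box \<Longrightarrow> H x \<le> H y"
    by (metis continuous_attains_inf empty_iff)
  have min: "H x \<le> H y" if supp: "\<And>j. j \<notin> J \<Longrightarrow> y j = 0" for y
  proof (cases "y \<in> box")
    case False
    then obtain k where "y k \<notin> (if k \<in> J then {-R..R} else {0})"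
      by (auto simp: box_def)
    then have k: "k \<in> J" "\<bar>y k\<bar> > R"
      using supp[of k] by (auto split: if_splits)
    have "H x \<le> R - card J * (2 / e)" using min_box[OF zero] by (simp add: R_def)
    also have "\<dots> \<le> \<bar>y k\<bar> - card J * (2 / e)" using k by simp
    also have "\<bar>y k\<bar> \<le> (\<Sum>j\<in>J. \<bar>y j\<bar>)" using k J by (intro member_le_sum) auto
    also have "(\<Sum>j\<in>J. \<bar>y j\<bar>) - card J * (2 / e) = (\<Sum>j\<in>J. \<bar>y j\<bar> - 2 / e)"
      by (simp add: sum_subtractf)
    also have "\<dots> \<le> H y" by (rule H_ge)
    finally show ?thesis by simp
  qed (rule min_box)
  have "(\<Sum>is\<in>I. count_list is j * w is * exp (sum_list (map x is))) < m * (a j + e) * exp (m * x j)"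
    if j: "j \<in> J" for j
  proof -
    let ?D = "m * (a j + e) * exp (m * x j)
      - (\<Sum>is\<in>I. count_list is j * w is * exp (sum_list (map x is))) - 1"
    have D1: "((\<lambda>t. \<Sum>k\<in>J. (a k + e) * exp (m * (x(j := t)) k)) has_real_derivative
        (\<Sum>k\<in>J. if k = j then m * (a j + e) * exp (m * x j) else 0)) (at (x j))"
      by (rule DERIV_sum) (auto intro!: derivative_eq_intros)
    have D2: "((\<lambda>t. \<Sum>is\<in>I. w is * exp (sum_list (map (x(j := t)) is))) has_real_derivative
        (\<Sum>is\<in>I. count_list is j * w is * exp (sum_list (map x is)))) (at (x j))"
      unfolding sum_list_map_fun_upd
      by (rule DERIV_sum) (auto intro!: derivative_eq_intros)
    have D3: "((\<lambda>t. \<Sum>k\<in>J. (x(j := t)) k) has_real_derivative (\<Sum>k\<in>J. if k = j then 1 else 0)) (at (x j))"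
      by (rule DERIV_sum) (auto intro!: derivative_eq_intros)
    have "((\<lambda>t. H (x(j := t))) has_real_derivative ?D) (at (x j))"
      unfolding H_def using DERIV_diff[OF DERIV_diff[OF D1 D2] D3] J j by simp
    moreover have "H (x(j := x j)) \<le> H (x(j := t))" for t
      using x j by (auto intro!: min simp: box_def Pi_iff split: if_splits)
    ultimately have "?D = 0"
      by (intro DERIV_local_min[where d = 1 and x = "x j" and f = "\<lambda>t. H (x(j := t))"]) auto
    then show ?thesis by simp
  qed
  then show ?thesis by blast
qed

text \<open>
  Let \<open>x\<^sub>p\<close> be minimal among the coordinates in \<open>is\<close>. The term of \<open>is\<close> in row \<open>p\<close> is at most
  \<open>m (a p + 1)\<close>, which bounds \<open>\<Sum>\<^sub>q (x\<^sub>q - x\<^sub>p)\<close> from above. All summands are nonnegative, so each one is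
  bounded, in particular \<open>x\<^sub>k - x\<^sub>p \<ge> x\<^sub>k - x\<^sub>j\<close>. The bound does not depend on \<open>x\<close>.
\<close>

lemma row_dominance_log_ratio_bound:
  fixes w :: "'a list \<Rightarrow> real" and a :: "'a \<Rightarrow> real" and m :: nat
  assumes J: "finite J" and I: "finite I" and m: "m \<ge> 1"
    and len: "\<And>is. is \<in> I \<Longrightarrow> length is = m \<and> set is \<subseteq> J"
    and w: "\<And>is. is \<in> I \<Longrightarrow> w is \<ge> 0"
    and edge: "is \<in> I" "w is > 0" "j \<in> set is" "k \<in> set is"
  shows "\<exists>C. \<forall>x :: 'a \<Rightarrow> real. (\<forall>j\<in>J. (\<Sum>is\<in>I. count_list is j * w is * exp (sum_list (map x is) - m * x j))
            \<le> m * (a j + 1)) \<longrightarrow> x k - x j \<le> C"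
proof -
  define S where "S = (\<Sum>j\<in>J. \<bar>a j\<bar>) + 1"
  have S: "S > 0" unfolding S_def by (smt (verit) sum_nonneg abs_ge_zero)
  have "x k - x j \<le> ln (m * S / w is)" if x: "\<forall>j\<in>J. (\<Sum>is\<in>I. count_list is j * w is * exp (sum_list (map x is) - m * x j))
            \<le> m * (a j + 1)" for x :: "'a \<Rightarrow> real"
  proof -
    obtain p where p: "p \<in> set is" and p_min: "\<And>q. q \<in> set is \<Longrightarrow> x p \<le> x q"
      using edge(3) ex_min_if_finite[of "x ` set is"]
      by (metis (no_types, lifting) List.finite_set empty_iff finite_imageI imageE image_eqI image_is_empty linorder_not_le)
    have pJ: "p \<in> J" using p len edge by auto
    have "w is * exp (sum_list (map x is) - m * x p)
        \<le> count_list is p * w is * exp (sum_list (map x is) - m * x p)"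
    proof -
      have "count_list is p \<noteq> 0" using p by (simp add: count_list_0_iff)
      then have "1 * w is \<le> count_list is p * w is"
        using edge by (intro mult_right_mono) auto
      then show ?thesis by (intro mult_right_mono) auto
    qed
    also have "\<dots> \<le> (\<Sum>is\<in>I. count_list is p * w is * exp (sum_list (map x is) - m * x p))"
      using edge(1) I w
      by (intro member_le_sum[of _ _ "\<lambda>is. count_list is p * w is * exp (sum_list (map x is) - m * x p)"]) auto
    also have "\<dots> \<le> m * (a p + 1)" using x pJ by blast
    also have "\<dots> \<le> m * S"
      using member_le_sum[of p J "\<lambda>j. \<bar>a j\<bar>"] pJ J unfolding S_def
      by (intro mult_left_mono) auto
    finally have "exp (sum_list (map x is) - m * x p) \<le> m * S / w is"
      using edge(2) by (simp add: field_simps)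
    then have 1: "sum_list (map x is) - m * x p \<le> ln (m * S / w is)"
      using S m edge(2) by (subst ln_ge_iff) auto
    have "x k - x p \<le> sum_list (map (\<lambda>q. x q - x p) is)"
      using edge(4) p_min by (intro member_le_sum_list) auto
    also have "\<dots> = sum_list (map x is) - m * x p"
      using len[OF edge(1)] by (simp add: sum_list_subtractf sum_list_triv)
    finally show ?thesis
      using 1 p_min[OF edge(3)] by linarith
  qed
  then show ?thesis by blast
qed

text \<open>
  The limit \<open>\<epsilon> \<rightarrow> 0\<close> of the perturbed statement. Dividing row \<open>j\<close> by \<open>exp (m x\<^sub>j)\<close> makes it
  invariant under shifts of \<open>x\<close> that are constant on the components of the hypergraph of positive
  weights, which is what lets the solutions be moved into one compact box.
\<close>

lemma row_dominance_of_nonneg_form: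
  fixes w :: "'a list \<Rightarrow> real" and a :: "'a \<Rightarrow> real" and m :: nat
  assumes J: "finite J" and I: "finite I" and m: "m \<ge> 1"
    and len: "\<And>is. is \<in> I \<Longrightarrow> length is = m \<and> set is \<subseteq> J"
    and w: "\<And>is. is \<in> I \<Longrightarrow> w is \<ge> 0"
    and nonneg: "\<And>x :: 'a \<Rightarrow> real.
      (\<Sum>is\<in>I. w is * exp (sum_list (map x is))) \<le> (\<Sum>j\<in>J. a j * exp (m * x j))"
  shows "\<exists>x :: 'a \<Rightarrow> real. \<forall>j\<in>J.
    (\<Sum>is\<in>I. count_list is j * w is * exp (sum_list (map x is) - m * x j)) \<le> m * a j"
proof -
  define row where
    "row x j = (\<Sum>is\<in>I. count_list is j * w is * exp (sum_list (map x is) - m * x j))"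
    for x :: "'a \<Rightarrow> real" and j
  have ex_approx: "\<exists>x. \<forall>j\<in>J. row x j \<le> m * (a j + e)" if e: "e > 0" for e
  proof -
    obtain x :: "'a \<Rightarrow> real" where x: "\<forall>j\<in>J. (\<Sum>is\<in>I. count_list is j * w is * exp (sum_list (map x is)))
        < m * (a j + e) * exp (m * x j)"
      using strict_row_dominance_of_nonneg_form[OF J I m e nonneg] by blast
    have "row x j = (\<Sum>is\<in>I. count_list is j * w is * exp (sum_list (map x is))) / exp (m * x j)" for j
      by (simp add: row_def exp_diff sum_divide_distrib)
    then have "\<forall>j\<in>J. row x j \<le> m * (a j + e)"
      using x by (auto simp: pos_divide_le_eq intro: less_imp_le)
    then show ?thesis by blast
  qed
  \<comment> \<open>The components are the classes of \<open>E\<^sup>*\<close>, and \<open>r\<close> chooses a representative of each.\<close>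
  define E where "E = {(j, k). \<exists>is\<in>I. w is > 0 \<and> j \<in> set is \<and> k \<in> set is}"
  have "sym E" by (auto simp: E_def sym_def)
  then have sym: "sym (E\<^sup>*)" by (rule sym_rtrancl)
  have bound: "\<exists>C. \<forall>x. (\<forall>j\<in>J. row x j \<le> m * (a j + 1)) \<longrightarrow> x k - x j \<le> C"
    if "(j, k) \<in> E\<^sup>*" for j k
    using that
  proof (induction rule: rtrancl_induct)
    case (step y z)
    obtain C1 where C1: "\<forall>x. (\<forall>j\<in>J. row x j \<le> m * (a j + 1)) \<longrightarrow> x y - x j \<le> C1"
      using step.IH by blast
    obtain "is" where "is \<in> I" "w is > 0" "y \<in> set is" "z \<in> set is"
      using step.hyps(2) by (auto simp: E_def)
    from row_dominance_log_ratio_bound[where a = a and w = w, OF J I m len w this]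
    obtain C2 where C2: "\<forall>x. (\<forall>j\<in>J. row x j \<le> m * (a j + 1)) \<longrightarrow> x z - x y \<le> C2"
      unfolding row_def by blast
    have "\<forall>x. (\<forall>j\<in>J. row x j \<le> m * (a j + 1)) \<longrightarrow> x z - x j \<le> C1 + C2"
      using C1 C2 by (smt (verit, best))
    then show ?case by blast
  qed auto
  define r where "r j = (SOME k. (j, k) \<in> E\<^sup>*)" for j
  have r: "(j, r j) \<in> E\<^sup>*" for j unfolding r_def by (rule someI[of _ j]) auto
  have r_eq: "r j = r k" if "(j, k) \<in> E" for j k
  proof -
    have "(j, l) \<in> E\<^sup>* \<longleftrightarrow> (k, l) \<in> E\<^sup>*" for l
      using that sym by (meson converse_rtrancl_into_rtrancl r_into_rtrancl rtrancl_trans symE)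
    then show ?thesis by (simp add: r_def)
  qed
  have "\<exists>B. \<forall>x. (\<forall>j\<in>J. row x j \<le> m * (a j + 1)) \<longrightarrow> \<bar>x j - x (r j)\<bar> \<le> B" for j
  proof -
    obtain C1 where C1: "\<forall>x. (\<forall>j\<in>J. row x j \<le> m * (a j + 1)) \<longrightarrow> x (r j) - x j \<le> C1"
      using bound[OF r] by blast
    obtain C2 where C2: "\<forall>x. (\<forall>j\<in>J. row x j \<le> m * (a j + 1)) \<longrightarrow> x j - x (r j) \<le> C2"
      using bound symD[OF sym r] by blast
    have "\<forall>x. (\<forall>j\<in>J. row x j \<le> m * (a j + 1)) \<longrightarrow> \<bar>x j - x (r j)\<bar> \<le> max C1 C2"
      using C1 C2 by (smt (verit, best))
    then show ?thesis by blast
  qed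
  then obtain B where B: "\<And>j x. \<forall>j\<in>J. row x j \<le> m * (a j + 1) \<Longrightarrow> \<bar>x j - x (r j)\<bar> \<le> B j"
    by metis
  have row_shift: "row (\<lambda>j. x j - x (r j)) j = row x j" for x j
    unfolding row_def
  proof (rule sum.cong[OF refl])
    fix "is" assume "is": "is \<in> I"
    show "count_list is j * w is * exp (sum_list (map (\<lambda>j. x j - x (r j)) is) - m * (x j - x (r j)))
        = count_list is j * w is * exp (sum_list (map x is) - m * x j)"
    proof (cases "j \<in> set is \<and> w is > 0")
      case True
      have "r q = r j" if "q \<in> set is" for q
        using True that "is" by (intro r_eq) (auto simp: E_def)
      then have "map (\<lambda>j. x j - x (r j)) is = map (\<lambda>q. x q - x (r j)) is" by simp
      also have "sum_list \<dots> = sum_list (map x is) - m * x (r j)"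
        using len[OF "is"] by (simp add: sum_list_subtractf sum_list_triv)
      finally have "sum_list (map (\<lambda>j. x j - x (r j)) is) = sum_list (map x is) - m * x (r j)" .
      then show ?thesis by (simp add: algebra_simps)
    next
      case False
      then have "count_list is j = 0 \<or> w is = 0" using w[OF "is"] by (auto simp: count_list_0_iff)
      then show ?thesis by auto
    qed
  qed
  define box where "box = Pi UNIV (\<lambda>j. {- B j..B j})"
  define F where "F e = {x. \<forall>j\<in>J. row x j \<le> m * (a j + e)}" for e
  have compact_box: "compact box" unfolding box_def by (rule compact_Pi_UNIV) auto
  have closed_F: "closed (F e)" for e
  proof -
    have "continuous_on UNIV (\<lambda>x. row x j)" for j
      unfolding row_def
      by (intro continuous_intros continuous_on_sum_list_coords continuous_on_product_coordinates)
    then have "closed {x. row x j \<le> m * (a j + e)}" for j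
      by (intro closed_Collect_le continuous_on_const)
    moreover have "F e = (\<Inter>j\<in>J. {x. row x j \<le> m * (a j + e)})" by (auto simp: F_def)
    ultimately show ?thesis by auto
  qed
  \<comment> \<open>The sets \<open>F e\<close> decrease with \<open>e\<close>, so a solution for the smallest \<open>e\<close> serves finitely many at
    once. The cap at \<open>1\<close> is the perturbation for which \<open>B\<close> is a bound.\<close>
  have fip: "box \<inter> (\<Inter>e\<in>T. F e) \<noteq> {}" if T: "finite T" "T \<subseteq> {0<..}" for T
  proof -
    define e where "e = Min (insert 1 T)"
    have e: "e > 0" "e \<le> 1" "\<And>t. t \<in> T \<Longrightarrow> e \<le> t" using T by (auto simp: e_def)
    obtain x where x: "\<forall>j\<in>J. row x j \<le> m * (a j + e)" using ex_approx[OF e(1)] by blast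
    have up: "\<forall>j\<in>J. row x j \<le> m * (a j + t)" if "e \<le> t" for t
      using x that by (auto intro!: order_trans[OF bspec[OF x] mult_left_mono])
    have "(\<lambda>j. x j - x (r j)) \<in> box"
      using B[OF up[OF e(2)]] by (auto simp: box_def abs_le_iff Pi_iff) (smt (verit))+
    moreover have "(\<lambda>j. x j - x (r j)) \<in> F t" if "t \<in> T" for t
      using up[OF e(3)[OF that]] by (simp add: F_def row_shift)
    ultimately show ?thesis by blast
  qed
  have "box \<inter> (\<Inter>e\<in>{0<..}. F e) \<noteq> {}"
    by (rule compact_imp_fip_image[OF compact_box closed_F fip]) auto
  then obtain x where x: "\<And>e. e > 0 \<Longrightarrow> x \<in> F e" by auto
  have "row x j \<le> m * a j" if "j \<in> J" for j
  proof (rule field_le_epsilon)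
    fix e :: real assume "e > 0"
    then have "row x j \<le> m * (a j + e / m)" using x[of "e / m"] m that by (auto simp: F_def)
    then show "row x j \<le> m * a j + e" using m by (simp add: algebra_simps)
  qed
  then show ?thesis unfolding row_def by blast
qed

section \<open>The characterization\<close>

theorem corollary2:
  fixes m n :: nat and A :: tensor
  assumes "m \<ge> 1" and "n \<ge> 1"
    and "A \<in> sym_tensors m n"
  shows "A \<in> GDD_plus m n \<longleftrightarrow>
    (\<exists>b :: nat list \<Rightarrow> nat \<Rightarrow> real.
       (\<forall>is\<in>offdiag_indices m n. \<forall>j\<in>set is. b is j \<ge> 0) \<and>
       (\<forall>is\<in>offdiag_indices m n.
          let (js, \<alpha>) = tight_pair is
          in (\<Prod>k<length js. b is (js ! k) ^ (\<alpha> ! k)) \<ge> tight_const m is * \<bar>A is\<bar> ^ m) \<and>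
       (\<forall>j\<in>{1..n}. diag_entry m A j \<ge> (\<Sum>is | is \<in> offdiag_indices m n \<and> j \<in> set is. b is j)))"
proof
  assume "A \<in> GDD_plus m n"
  then obtain x :: "nat \<Rightarrow> real" where x: "\<forall>j\<in>{1..n}. (\<Sum>is | is \<in> offdiag_indices m n \<and> j \<in> set is.
        num_arrangements is * count_list is j / m * (\<bar>A is\<bar> * exp (sum_list (map x is) - m * x j)))
      \<le> diag_entry m A j"
    using GDD_plus_iff_exp_row_sums[OF assms(3,1)] by blast
  define b where "b is j = num_arrangements is * count_list is j / m *
      (\<bar>A is\<bar> * exp (sum_list (map x is) - m * x j))" for "is" j
  show "\<exists>b :: nat list \<Rightarrow> nat \<Rightarrow> real.
       (\<forall>is\<in>offdiag_indices m n. \<forall>j\<in>set is. b is j \<ge> 0) \<and>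
       (\<forall>is\<in>offdiag_indices m n.
          let (js, \<alpha>) = tight_pair is
          in (\<Prod>k<length js. b is (js ! k) ^ (\<alpha> ! k)) \<ge> tight_const m is * \<bar>A is\<bar> ^ m) \<and>
       (\<forall>j\<in>{1..n}. diag_entry m A j \<ge> (\<Sum>is | is \<in> offdiag_indices m n \<and> j \<in> set is. b is j))"
  proof (intro exI[of _ b] conjI ballI)
    fix "is" j
    show "b is j \<ge> 0" by (simp add: b_def num_arrangements_nonneg)
  next
    fix "is" assume "is": "is \<in> offdiag_indices m n"
    obtain js \<alpha> where tp: "tight_pair is = (js, \<alpha>)" by fastforce
    have "(\<Prod>k<length js. b is (js ! k) ^ (\<alpha> ! k)) = tight_const m is * \<bar>A is\<bar> ^ m"
      unfolding tight_pair_prod_eq[OF tp, of "b is"] unfolding b_def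
      by (rule prod_scaled_entries_eq_tight_const[OF offdiag_indicesD(1)[OF "is"]])
    then show "let (js, \<alpha>) = tight_pair is
        in (\<Prod>k<length js. b is (js ! k) ^ (\<alpha> ! k)) \<ge> tight_const m is * \<bar>A is\<bar> ^ m"
      by (simp add: tp)
  next
    fix j assume "j \<in> {1..n}"
    with x show "diag_entry m A j \<ge> (\<Sum>is | is \<in> offdiag_indices m n \<and> j \<in> set is. b is j)"
      unfolding b_def by blast
  qed
next
  let ?I = "offdiag_indices m n" and ?w = "\<lambda>is. num_arrangements is * \<bar>A is\<bar>"
  assume "\<exists>b :: nat list \<Rightarrow> nat \<Rightarrow> real.
       (\<forall>is\<in>offdiag_indices m n. \<forall>j\<in>set is. b is j \<ge> 0) \<and>
       (\<forall>is\<in>offdiag_indices m n.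
          let (js, \<alpha>) = tight_pair is
          in (\<Prod>k<length js. b is (js ! k) ^ (\<alpha> ! k)) \<ge> tight_const m is * \<bar>A is\<bar> ^ m) \<and>
       (\<forall>j\<in>{1..n}. diag_entry m A j \<ge> (\<Sum>is | is \<in> offdiag_indices m n \<and> j \<in> set is. b is j))"
  then obtain b :: "nat list \<Rightarrow> nat \<Rightarrow> real" where
    b0: "\<And>is j. is \<in> ?I \<Longrightarrow> j \<in> set is \<Longrightarrow> b is j \<ge> 0" and
    b1: "\<And>is. is \<in> ?I \<Longrightarrow> (let (js, \<alpha>) = tight_pair is
          in (\<Prod>k<length js. b is (js ! k) ^ (\<alpha> ! k)) \<ge> tight_const m is * \<bar>A is\<bar> ^ m)" and
    b2: "\<And>j. j \<in> {1..n} \<Longrightarrow> diag_entry m A j \<ge> (\<Sum>is | is \<in> ?I \<and> j \<in> set is. b is j)"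
    by blast
  have tight: "tight_const m is * \<bar>A is\<bar> ^ m \<le> (\<Prod>j\<in>set is. b is j ^ count_list is j)"
    if "is \<in> ?I" for "is"
    using b1[OF that] tight_pair_prod_eq[of "is" _ _ "b is"] by (auto split: prod.splits)
  \<comment> \<open>Condition (i) splits each monomial among the variables that occur in it, and (ii) says that
    the diagonal entries pay for all shares.\<close>
  have nonneg: "(\<Sum>is\<in>?I. ?w is * exp (sum_list (map x is)))
      \<le> (\<Sum>j\<in>{1..n}. diag_entry m A j * exp (m * x j))" for x :: "nat \<Rightarrow> real"
  proof -
    have "(\<Sum>is\<in>?I. ?w is * exp (sum_list (map x is)))
        \<le> (\<Sum>is\<in>?I. \<Sum>j\<in>set is. b is j * exp (m * x j))"
      using b0 tight assms(1) offdiag_indicesD(1)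
      by (intro sum_mono monomial_le_sum_powers) auto
    also have "\<dots> = (\<Sum>is\<in>?I. \<Sum>j | j \<in> {1..n} \<and> j \<in> set is. b is j * exp (m * x j))"
      by (intro sum.cong refl) (use offdiag_indicesD(2) in blast)
    also have "\<dots> = (\<Sum>j\<in>{1..n}. \<Sum>is | is \<in> ?I \<and> j \<in> set is. b is j * exp (m * x j))"
      by (intro sum.swap_restrict finite_offdiag_indices finite_atLeastAtMost)
    also have "\<dots> \<le> (\<Sum>j\<in>{1..n}. diag_entry m A j * exp (m * x j))"
      using b2 by (intro sum_mono) (auto simp flip: sum_distrib_right intro: mult_right_mono)
    finally show ?thesis .
  qed
  have "\<exists>x :: nat \<Rightarrow> real. \<forall>j\<in>{1..n}.
      (\<Sum>is\<in>?I. count_list is j * ?w is * exp (sum_list (map x is) - m * x j)) \<le> m * diag_entry m A j"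
    by (rule row_dominance_of_nonneg_form)
      (use assms(1) nonneg finite_offdiag_indices offdiag_indicesD num_arrangements_nonneg in
        \<open>auto intro!: mult_nonneg_nonneg\<close>)
  then obtain x :: "nat \<Rightarrow> real" where x: "\<forall>j\<in>{1..n}.
      (\<Sum>is\<in>?I. count_list is j * ?w is * exp (sum_list (map x is) - m * x j)) \<le> m * diag_entry m A j"
    by blast
  have "(\<Sum>is | is \<in> ?I \<and> j \<in> set is.
        num_arrangements is * count_list is j / m * (\<bar>A is\<bar> * exp (sum_list (map x is) - m * x j)))
      \<le> diag_entry m A j" if j: "j \<in> {1..n}" for j
  proof -
    have "(\<Sum>is | is \<in> ?I \<and> j \<in> set is.
        num_arrangements is * count_list is j / m * (\<bar>A is\<bar> * exp (sum_list (map x is) - m * x j)))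
      = (\<Sum>is\<in>?I. count_list is j * ?w is * exp (sum_list (map x is) - m * x j) / m)"
      using finite_offdiag_indices[of m n]
      by (intro sum.mono_neutral_cong_left) (auto simp: count_list_0_iff)
    also have "\<dots> \<le> diag_entry m A j"
      using x j assms(1) by (simp add: pos_divide_le_eq mult.commute flip: sum_divide_distrib)
    finally show ?thesis .
  qed
  moreover have "diag_entry m A j \<ge> 0" if "j \<in> {1..n}" for j
    by (rule order_trans[OF sum_nonneg b2[OF that]]) (use b0 in auto)
  ultimately show "A \<in> GDD_plus m n"
    using GDD_plus_iff_exp_row_sums[OF assms(3,1)] by blast
qed

end
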